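(* Let $\Omega,\Theta\subset\mathbb{R}^n$ be nonempty closed convex sets with $\Omega\setminus\Theta\ne\emptyset$, and let $\alpha=\beta>0$. Let $S_1$ be the solution set of $$\min\{\alpha d(x;\Omega)-\beta d(x;\Theta)\;|\;x\in\mathbb{R}^n\}$$ and let $S_2$ be the solution set of $$\max\{d(x;\Theta)\;|\;x\in\Omega\}.$$ Then $$S_1=\left\{\bar u+\mathbb{R}^{+}\left(\bar u-P(\bar u;\Theta)\right)\;\big|\;\bar u\in S_2\right\},$$ i.e., $S_1$ is the set of all points $\bar u+t(\bar u-P(\bar u;\Theta))$ with $\bar u\in S_2$ and $t\ge0$.
   Context: $\mathbb{R}^n$ carries the Euclidean norm $\|\cdot\|$. For a nonempty closed convex set $Q\subset\mathbb{R}^n$, $d(x;Q)=\inf\{\|x-w\|\;|\;w\in Q\}$ is the distance function and $P(x;Q)$ is the Euclidean projection of $x$ to $Q$, i.e., the unique $w\in Q$ with $\|x-w\|=d(x;Q)$. $\mathbb{R}^+=[0,\infty)$. Solution sets consist of global optimal solutions (feasible points attaining the optimum) and may be empty. *)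

theory Defs
  imports "HOL-Analysis.Analysis"
begin

(* The solution sets consist of global optimal solutions, and are empty when the optimum is
   not attained. *)

definition min_solutions :: "('a \<Rightarrow> real) \<Rightarrow> 'a set \<Rightarrow> 'a set" where
  "min_solutions f A = {x. is_arg_min f (\<lambda>y. y \<in> A) x}"

definition max_solutions :: "('a \<Rightarrow> real) \<Rightarrow> 'a set \<Rightarrow> 'a set" where
  "max_solutions f A = {x. is_arg_max f (\<lambda>y. y \<in> A) x}"

end

theory Submission
  imports Defs
begin

text \<open>
  Since \<open>infdist _ \<Theta>\<close> is 1-Lipschitz, replacing a point \<open>x\<close> by its projection \<open>w\<close> to \<open>\<Omega>\<close>
  never increases \<open>infdist x \<Omega> - infdist x \<Theta>\<close>: the first distance drops by \<open>dist x w\<close> and the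
  second one by at most that much. On \<open>\<Omega>\<close> the objective is \<open>- infdist _ \<Theta>\<close>, so minimizing it
  over the whole space amounts to maximizing the distance to \<open>\<Theta>\<close> over \<open>\<Omega>\<close>; a minimizer \<open>x\<close> is
  precisely a point whose projection \<open>w\<close> is a maximizer and for which nothing is gained, i.e.
  \<open>infdist x \<Theta> = infdist w \<Theta> + dist x w\<close>.

  It remains to see where this Lipschitz estimate is sharp. Along the ray that leaves \<open>\<Theta>\<close> at
  the projection of \<open>w\<close> and passes through \<open>w\<close>, the projection to the convex set \<open>\<Theta>\<close> does not
  change, so the distance grows at unit speed (\<open>infdist_beyond_closest_point\<close>). Conversely,
  sharpness forces equality in the triangle inequality for \<open>x\<close>, \<open>w\<close> and the projection of \<open>w\<close>,
  which puts \<open>x\<close> on that ray (\<open>on_ray_if_infdist_eq_add_dist\<close>); the direction of the ray is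
  nonzero because the maximal distance is positive as soon as \<open>\<Omega>\<close> is not contained in \<open>\<Theta>\<close>.
\<close>

lemma infdist_eq_dist_closest_point:
  fixes S :: "'a::{real_inner,heine_borel} set"
  assumes "closed S" "S \<noteq> {}"
  shows "infdist x S = dist x (closest_point S x)"
  using assms by (simp add: infdist_eq_setdist setdist_closest_point)

text \<open>
  The projection \<open>p\<close> of \<open>u\<close> is characterized by \<open>(u - p) \<bullet> (z - p) \<le> 0\<close> for all \<open>z\<close> in the set,
  and this condition depends only on the direction of \<open>u - p\<close>. Hence every point of the ray
  from \<open>p\<close> through \<open>u\<close> has the same projection \<open>p\<close>.
\<close>
lemma infdist_beyond_closest_point:
  fixes S :: "'a::{real_inner,heine_borel} set"
  assumes "closed S" "convex S" "S \<noteq> {}" "t \<ge> 0"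
  shows "infdist (u + t *\<^sub>R (u - closest_point S u)) S = infdist u S + t * infdist u S"
proof -
  define p where "p = closest_point S u"
  define x where "x = u + t *\<^sub>R (u - p)"
  have p: "p \<in> S"
    using assms by (simp add: p_def closest_point_in_set)
  have x: "x - p = (1 + t) *\<^sub>R (u - p)"
    by (simp add: x_def algebra_simps)
  have "dist x p \<le> dist x z" if "z \<in> S" for z
  proof -
    have "(u - p) \<bullet> (z - p) \<le> 0"
      using assms that by (simp add: p_def closest_point_dot)
    then have "(x - p) \<bullet> (z - p) \<le> 0"
      using \<open>t \<ge> 0\<close> by (simp add: x mult_nonneg_nonpos)
    moreover have "(norm (x - z))\<^sup>2 = (norm (x - p))\<^sup>2 + (norm (z - p))\<^sup>2 - 2 * ((x - p) \<bullet> (z - p))"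
      by (simp add: power2_norm_eq_inner inner_commute algebra_simps)
    ultimately have "(norm (x - p))\<^sup>2 \<le> (norm (x - z))\<^sup>2"
      using zero_le_power2[of "norm (z - p)"] by linarith
    then show ?thesis
      by (simp add: dist_norm)
  qed
  then have "p = closest_point S x"
    using assms p by (intro closest_point_unique) auto
  then have "infdist x S = dist x p"
    using assms by (simp add: infdist_eq_dist_closest_point)
  also have "\<dots> = (1 + t) * dist u p"
    using \<open>t \<ge> 0\<close> by (simp add: dist_norm x)
  also have "dist u p = infdist u S"
    using assms by (simp add: infdist_eq_dist_closest_point p_def)
  finally show ?thesis
    by (simp add: x_def p_def algebra_simps)
qed

text \<open>
  The point \<open>p\<close> of \<open>S\<close> closest to \<open>w\<close> satisfies \<open>dist x p \<ge> infdist x S\<close>, so the hypothesis makes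
  \<open>w\<close> lie between \<open>x\<close> and \<open>p\<close>. Were \<open>w\<close> in \<open>S\<close>, the ray would degenerate to a point.
\<close>
lemma on_ray_if_infdist_eq_add_dist:
  fixes S :: "'a::{real_inner,heine_borel} set"
  assumes "closed S" "S \<noteq> {}" "w \<notin> S"
    and eq: "infdist x S = infdist w S + dist x w"
  obtains t where "t \<ge> 0" "x = w + t *\<^sub>R (w - closest_point S w)"
proof
  define p where "p = closest_point S w"
  have p: "p \<in> S"
    using assms by (simp add: p_def closest_point_in_set)
  then have ne: "norm (w - p) > 0"
    using \<open>w \<notin> S\<close> by auto
  have "dist x p \<ge> dist x w + dist w p"
    using eq infdist_le[OF p, of x] assms by (simp add: infdist_eq_dist_closest_point p_def)
  then have "norm ((x - w) + (w - p)) = norm (x - w) + norm (w - p)"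
    using norm_triangle_ineq[of "x - w" "w - p"] by (simp add: dist_norm)
  then have "norm (x - w) *\<^sub>R (w - p) = norm (w - p) *\<^sub>R (x - w)"
    by (simp only: norm_triangle_eq)
  then have "(norm (x - w) / norm (w - p)) *\<^sub>R (w - p) = x - w"
    using ne by (simp add: vector_fraction_eq_iff)
  then show "x = w + (norm (x - w) / norm (w - p)) *\<^sub>R (w - closest_point S w)"
    by (simp add: p_def)
qed simp

theorem proposition4p6:
  fixes \<Omega> \<Theta> S\<^sub>1 S\<^sub>2 :: "(real ^ 'n) set" and \<alpha> \<beta> :: real
  assumes "\<Omega> \<noteq> {}" "closed \<Omega>" "convex \<Omega>"
    and "\<Theta> \<noteq> {}" "closed \<Theta>" "convex \<Theta>"
    and "\<Omega> - \<Theta> \<noteq> {}"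
    and "\<alpha> = \<beta>" "\<beta> > 0"
    and "S\<^sub>1 = min_solutions (\<lambda>x. \<alpha> * infdist x \<Omega> - \<beta> * infdist x \<Theta>) UNIV"
    and "S\<^sub>2 = max_solutions (\<lambda>x. infdist x \<Theta>) \<Omega>"
  shows "S\<^sub>1 = {u + t *\<^sub>R (u - closest_point \<Theta> u) | u t. u \<in> S\<^sub>2 \<and> t \<ge> 0}"
proof -
  define f where "f x = infdist x \<Omega> - infdist x \<Theta>" for x
  have "\<alpha> * infdist x \<Omega> - \<beta> * infdist x \<Theta> = \<beta> * f x" for x
    by (simp add: f_def \<open>\<alpha> = \<beta>\<close> right_diff_distrib)
  then have S1: "x \<in> S\<^sub>1 \<longleftrightarrow> (\<forall>y. f x \<le> f y)" for x
    using \<open>\<beta> > 0\<close> by (simp add: assms(10) min_solutions_def is_arg_min_def not_less)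
  have S2: "u \<in> S\<^sub>2 \<longleftrightarrow> u \<in> \<Omega> \<and> (\<forall>v\<in>\<Omega>. infdist v \<Theta> \<le> infdist u \<Theta>)" for u
    by (auto simp: assms(11) max_solutions_def is_arg_max_def not_less)
  have f_on_\<Omega>: "f v = - infdist v \<Theta>" if "v \<in> \<Omega>" for v
    using that by (simp add: f_def)
  have proj: "closest_point \<Omega> x \<in> \<Omega>" for x
    using assms by (simp add: closest_point_in_set)
  have f_proj: "f (closest_point \<Omega> x) \<le> f x" for x
    using infdist_triangle[of x \<Theta> "closest_point \<Omega> x"] assms
    by (simp add: f_on_\<Omega> proj) (simp add: f_def infdist_eq_dist_closest_point)
  have S2_outside: "u \<notin> \<Theta>" if u: "u \<in> S\<^sub>2" for u
  proof
    assume "u \<in> \<Theta>"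
    obtain v where v: "v \<in> \<Omega>" "v \<notin> \<Theta>"
      using assms(7) by blast
    then have "infdist v \<Theta> > 0"
      using assms by (simp add: infdist_pos_not_in_closed)
    then show False
      using u v \<open>u \<in> \<Theta>\<close> by (fastforce simp: S2)
  qed
  have "\<exists>u t. x = u + t *\<^sub>R (u - closest_point \<Theta> u) \<and> u \<in> S\<^sub>2 \<and> t \<ge> 0" if x: "x \<in> S\<^sub>1" for x
  proof -
    define w where "w = closest_point \<Omega> x"
    have w: "w \<in> \<Omega>" and fw: "f w = f x"
      using x f_proj[of x] proj[of x] by (auto simp: w_def S1 intro: antisym)
    have "infdist v \<Theta> \<le> infdist w \<Theta>" if "v \<in> \<Omega>" for v
    proof -
      have "f w \<le> f v"
        using x fw by (simp add: S1)
      then show ?thesis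
        using that w by (simp add: f_on_\<Omega>)
    qed
    with w have "w \<in> S\<^sub>2"
      by (simp add: S2)
    moreover have "infdist x \<Theta> = infdist w \<Theta> + dist x w"
      using fw w assms by (simp add: f_on_\<Omega>) (simp add: f_def infdist_eq_dist_closest_point w_def)
    ultimately show ?thesis
      using on_ray_if_infdist_eq_add_dist[of \<Theta> w x] S2_outside assms by metis
  qed
  moreover have "u + t *\<^sub>R (u - closest_point \<Theta> u) \<in> S\<^sub>1" if u: "u \<in> S\<^sub>2" and t: "t \<ge> 0" for u t
  proof -
    define x where "x = u + t *\<^sub>R (u - closest_point \<Theta> u)"
    have "infdist x \<Omega> \<le> dist x u"
      using u by (simp add: S2 infdist_le)
    also have "\<dots> = t * infdist u \<Theta>"
      using t assms by (simp add: x_def dist_norm infdist_eq_dist_closest_point)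
    finally have "f x \<le> - infdist u \<Theta>"
      using infdist_beyond_closest_point[of \<Theta> t u] t assms by (simp add: f_def x_def)
    also have "- infdist u \<Theta> \<le> f y" for y
      using f_proj[of y] u proj[of y] by (fastforce simp: S2 f_on_\<Omega>)
    finally show ?thesis
      by (simp add: S1 x_def)
  qed
  ultimately show ?thesis
    by blast
qed

end
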